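(* Let $d\ge 1$ and let $\{f_1,\dots,f_n\}$ ($n>0$) be an iterated function system on $\mathbb{R}^d$, i.e. a finite family of contractions of $\mathbb{R}^d$. Let $A$ be its invariant set, i.e. the unique nonempty closed bounded set $A\subset\mathbb{R}^d$ with $A=\bigcup_{j=1}^n f_j(A)$. Then $A$ is the minimal invariant set of the R-IFS $\{\mathrm{id},f_1,\dots,f_n\}$, where $\mathrm{id}$ is the identity mapping of $\mathbb{R}^d$.
   Context: $\mathbb{R}^d$ carries the Euclidean norm. A map $f$ on a metric space $(X,\rho)$ is a (Banach) contraction if there is $\alpha\in[0,1)$ with $\rho(f(x),f(y))\le\alpha\,\rho(x,y)$ for all $x,y$; it is isometric if $\rho(f(x),f(y))=\rho(x,y)$ for all $x,y$. By Hutchinson's theorem a finite nonempty family of contractions of $\mathbb{R}^d$ has a unique nonempty closed bounded invariant set. An R-IFS on $\mathbb{R}^d$ is a function system $\{R_1,\dots,R_m,f_1,\dots,f_n\}$ with $m,n>0$, where each $R_i:\mathbb{R}^d\to\mathbb{R}^d$ is an isometric mapping with $R_i(0)=0$ and each $f_j:\mathbb{R}^d\to\mathbb{R}^d$ is a contraction. An invariant set of a finite system $\mathcal{F}$ of continuous self-maps of $X$ is a nonempty closed set $S\subset X$ with $\bigcup_{f\in\mathcal{F}} f(S)=S$. The minimal invariant set of $\mathcal{F}$ is the invariant set of $\mathcal{F}$ contained in every invariant set of $\mathcal{F}$. *)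

theory Defs
  imports "HOL-Analysis.Analysis"
begin

definition contraction :: "('a::metric_space \<Rightarrow> 'a) \<Rightarrow> bool" where
  "contraction f \<longleftrightarrow>
     (\<exists>\<alpha>::real. 0 \<le> \<alpha> \<and> \<alpha> < 1 \<and> (\<forall>x y. dist (f x) (f y) \<le> \<alpha> * dist x y))"

definition isometric :: "('a::metric_space \<Rightarrow> 'a) \<Rightarrow> bool" where
  "isometric f \<longleftrightarrow> (\<forall>x y. dist (f x) (f y) = dist x y)"

definition ifs :: "(real ^ 'd \<Rightarrow> real ^ 'd) set \<Rightarrow> bool" where
  "ifs \<F> \<longleftrightarrow> finite \<F> \<and> \<F> \<noteq> {} \<and> (\<forall>f\<in>\<F>. contraction f)"

text \<open>An R-IFS is given by its isometric part \<open>\<R>\<close> and its contractive part \<open>\<F>\<close>, so that the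
  two roles need not be recovered from the maps; the function system itself is \<open>\<R> \<union> \<F>\<close>.\<close>

definition r_ifs ::
  "(real ^ 'd \<Rightarrow> real ^ 'd) set \<Rightarrow> (real ^ 'd \<Rightarrow> real ^ 'd) set \<Rightarrow> bool" where
  "r_ifs \<R> \<F> \<longleftrightarrow>
     finite \<R> \<and> \<R> \<noteq> {} \<and> (\<forall>R\<in>\<R>. isometric R \<and> R 0 = 0) \<and>
     finite \<F> \<and> \<F> \<noteq> {} \<and> (\<forall>f\<in>\<F>. contraction f)"

text \<open>Invariant sets need not be bounded. The definitions below are meant for finite systems of
  continuous maps; this is a property of the system and not part of the predicates.\<close>

definition invariant_set :: "('a::topological_space \<Rightarrow> 'a) set \<Rightarrow> 'a set \<Rightarrow> bool" where
  "invariant_set \<F> S \<longleftrightarrow> S \<noteq> {} \<and> closed S \<and> (\<Union>f\<in>\<F>. f ` S) = S"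

definition minimal_invariant_set :: "('a::topological_space \<Rightarrow> 'a) set \<Rightarrow> 'a set \<Rightarrow> bool" where
  "minimal_invariant_set \<F> S \<longleftrightarrow>
     invariant_set \<F> S \<and> (\<forall>T. invariant_set \<F> T \<longrightarrow> S \<subseteq> T)"

end

(* If T is closed, nonempty and mapped into itself by every f_j, then the distance to T attains
   its maximum over the compact set A at some point f_j(b) with b in A, and applying f_j to the
   point of T nearest to b shrinks the distance; so the maximum is 0 and A is contained in T. *)
theory Submission
  imports Defs
begin

text \<open>Stated for closed sets \<open>T\<close> that are merely forward invariant, possibly
  unbounded, because invariance under the system enlarged by \<open>id\<close> says no more than
  this about \<open>T\<close>.\<close>

lemma bounded_invariant_set_subset_forward_invariant:
  fixes A T :: "'a::heine_borel set"
  assumes contr: "\<And>g. g \<in> \<F> \<Longrightarrow> contraction g"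
    and A: "invariant_set \<F> A" "bounded A"
    and T: "T \<noteq> {}" "closed T" "\<And>g. g \<in> \<F> \<Longrightarrow> g ` T \<subseteq> T"
  shows "A \<subseteq> T"
proof -
  have "compact A" and "A \<noteq> {}" and A_eq: "(\<Union>g\<in>\<F>. g ` A) = A"
    using A by (auto simp: invariant_set_def compact_eq_bounded_closed)
  moreover have "continuous_on A (\<lambda>x. infdist x T)"
    by (intro continuous_intros)
  ultimately obtain a where "a \<in> A" and max: "\<And>x. x \<in> A \<Longrightarrow> infdist x T \<le> infdist a T"
    using continuous_attains_sup by metis
  \<comment> \<open>The inclusion of \<open>A\<close> in the union of its images pulls the maximizer
    back to a point \<open>b\<close> of \<open>A\<close>, where the maximum bounds the distance as
    well.\<close>
  then obtain g b where g: "g \<in> \<F>" and b: "b \<in> A" and a: "a = g b"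
    using A_eq by blast
  obtain t where t: "t \<in> T" "infdist b T = dist b t"
    using infdist_attains_inf T by metis
  obtain \<alpha> where \<alpha>: "0 \<le> \<alpha>" "\<alpha> < 1" "dist (g b) (g t) \<le> \<alpha> * dist b t"
    using contr[OF g] unfolding contraction_def by blast
  have "infdist a T \<le> dist (g b) (g t)"
    unfolding a using T(3)[OF g] t(1) by (intro infdist_le) auto
  also have "\<dots> \<le> \<alpha> * infdist b T"
    using \<alpha>(3) t(2) by simp
  also have "\<dots> \<le> \<alpha> * infdist a T"
    using max[OF b] \<alpha>(1) by (rule mult_left_mono)
  finally have "(1 - \<alpha>) * infdist a T \<le> 0"
    by (simp add: algebra_simps)
  then have "infdist a T \<le> 0"
    using \<alpha>(2) by (simp add: mult_le_0_iff)
  then have "infdist x T = 0" if "x \<in> A" for x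
    using max[OF that] infdist_nonneg[of x T] by linarith
  \<comment> \<open>Distance zero means membership only for closed nonempty \<open>T\<close>: by
    convention \<open>infdist x {} = 0\<close>.\<close>
  then show ?thesis
    using T in_closed_iff_infdist_zero by blast
qed

theorem mainTheorem5:
  fixes f :: "nat \<Rightarrow> real ^ 'd \<Rightarrow> real ^ 'd" and n :: nat and A :: "(real ^ 'd) set"
  assumes "n > 0"
    and "ifs (f ` {1..n})"
    and "invariant_set (f ` {1..n}) A" and "bounded A"
  shows "r_ifs {id} (f ` {1..n}) \<and> minimal_invariant_set ({id} \<union> f ` {1..n}) A"
proof
  show "r_ifs {id} (f ` {1..n})"
    using assms(2) by (auto simp: r_ifs_def ifs_def isometric_def)
  have "A \<subseteq> T" if "invariant_set ({id} \<union> f ` {1..n}) T" for T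
  proof (rule bounded_invariant_set_subset_forward_invariant)
    show "contraction g" if "g \<in> f ` {1..n}" for g
      using that assms(2) by (auto simp: ifs_def)
    show "T \<noteq> {}" "closed T"
      using that by (auto simp: invariant_set_def)
    \<comment> \<open>The image under \<open>id\<close> already covers \<open>T\<close>, so the
      content of this equation is that every other image lies in \<open>T\<close>.\<close>
    have "(\<Union>g\<in>{id} \<union> f ` {1..n}. g ` T) = T"
      using that by (simp add: invariant_set_def)
    then show "g ` T \<subseteq> T" if "g \<in> f ` {1..n}" for g
      using that by blast
  qed (use assms in auto)
  \<comment> \<open>Adding \<open>id\<close> contributes only \<open>A\<close> itself to the union
    of images.\<close>
  moreover have "invariant_set ({id} \<union> f ` {1..n}) A"
    using assms(3) by (simp add: invariant_set_def)
  ultimately show "minimal_invariant_set ({id} \<union> f ` {1..n}) A"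
    by (simp add: minimal_invariant_set_def)
qed

end
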